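(* Let $S=(a_1,\dots,a_n),(b_1,\dots,b_{n'})$ be a sequence of positive integers and let $F=F_E\cup F_N$ be a set of fixed edges and non-edges such that $F$ does not contain a cycle of length eight. Let $G=(V,U,E)$ and $G'=(V,U,E')$ be two different $F$-fixed realisations of $S$. Then there exist $F$-fixed realisations $G_1,\dots,G_k$ of $S$ with $G_1=G$, $G_k=G'$ and $k\le\frac12|G\triangle G'|$ such that, for every $1\le i<k$, $|G_i\triangle G_{i+1}|\le 6$ and $G_i\triangle G_{i+1}$ corresponds to a $4$-swap or a $6$-swap of $G_i$.
   Context: Let $V=\{v_1,\dots,v_n\}$ and $U=\{u_1,\dots,u_{n'}\}$ be disjoint finite vertex sets. $F_E$ and $F_N$ are sets of vertex pairs $\{v_i,u_j\}$ with $v_i\in V$, $u_j\in U$ (fixed edges and fixed non-edges), and $F=F_E\cup F_N$. The set $F$ is regarded as the edge set of a bipartite graph on $V\cup U$; "$F$ contains a cycle of length eight" means that this graph contains a cycle with 8 distinct vertices (not necessarily induced). An $F$-fixed realisation of $S$ is a labeled simple bipartite graph $G=(V,U,E)$ (all edges between $V$ and $U$) with $d_G(v_i)=a_i$ for all $v_i\in V$, $d_G(u_j)=b_j$ for all $u_j\in U$, $F_E\subseteq E$ and $F_N\cap E=\emptyset$. For realisations $G,G'$, $G\triangle G'$ denotes the symmetric difference $E(G)\triangle E(G')$ of the edge sets. An alternating cycle of $G$ is a cycle of vertex pairs from $V\times U$ whose pairs are alternately in $E(G)$ and not in $E(G)$. A $j$-swap of $G$ is the operation that takes an alternating cycle of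 $G$ of length $j$ with no repeated vertex, deletes from $G$ its pairs lying in $E(G)$, and adds its pairs not lying in $E(G)$. "$G_i\triangle G_{i+1}$ corresponds to a $j$-swap of $G_i$" means that $G_i\triangle G_{i+1}$ is the set of pairs of such an alternating cycle of $G_i$ of length $j$. *)

theory Defs
  imports Complex_Main
begin

(* Undirected edges are two-element vertex sets. *)

definition vertex_pairs :: "'a set \<Rightarrow> 'a set \<Rightarrow> 'a set set" where
  "vertex_pairs V U = {{x, y} | x y. x \<in> V \<and> y \<in> U}"

definition degree :: "'a set set \<Rightarrow> 'a \<Rightarrow> nat" where
  "degree E x = card {e \<in> E. x \<in> e}"

(* Sequences and vertex enumerations are indexed by {1..n} and {1..n'}; values of
   the functions outside these ranges are irrelevant. *)

definition fixed_realisation ::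
  "nat \<Rightarrow> nat \<Rightarrow> (nat \<Rightarrow> 'a) \<Rightarrow> (nat \<Rightarrow> 'a) \<Rightarrow> (nat \<Rightarrow> nat) \<Rightarrow> (nat \<Rightarrow> nat) \<Rightarrow>
   'a set set \<Rightarrow> 'a set set \<Rightarrow> 'a set set \<Rightarrow> bool" where
  "fixed_realisation n n' v u a b FE FN E \<longleftrightarrow>
     E \<subseteq> vertex_pairs (v ` {1..n}) (u ` {1..n'}) \<and>
     (\<forall>i\<in>{1..n}. degree E (v i) = a i) \<and>
     (\<forall>j\<in>{1..n'}. degree E (u j) = b j) \<and>
     FE \<subseteq> E \<and> FN \<inter> E = {}"

definition cycle_pair :: "'a list \<Rightarrow> nat \<Rightarrow> 'a set" where
  "cycle_pair xs i = {xs ! (i mod length xs), xs ! (Suc i mod length xs)}"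

definition cycle_pairs :: "'a list \<Rightarrow> 'a set set" where
  "cycle_pairs xs = cycle_pair xs ` {..<length xs}"

definition is_cycle :: "'a set set \<Rightarrow> 'a list \<Rightarrow> bool" where
  "is_cycle E xs \<longleftrightarrow> length xs \<ge> 3 \<and> distinct xs \<and> cycle_pairs xs \<subseteq> E"

definition contains_cycle_of_length :: "nat \<Rightarrow> 'a set set \<Rightarrow> bool" where
  "contains_cycle_of_length l E \<longleftrightarrow> (\<exists>xs. is_cycle E xs \<and> length xs = l)"

(* The alternation condition includes the wrap-around from the last pair to the first,
   since cycle_pair reduces its index modulo the length. *)

definition alternating_cycle ::
  "'a set \<Rightarrow> 'a set \<Rightarrow> 'a set set \<Rightarrow> 'a list \<Rightarrow> bool" where
  "alternating_cycle V U E xs \<longleftrightarrow>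
     is_cycle (vertex_pairs V U) xs \<and>
     (\<forall>i<length xs. cycle_pair xs i \<in> E \<longleftrightarrow> cycle_pair xs (Suc i) \<notin> E)"

definition corresponds_to_swap ::
  "'a set \<Rightarrow> 'a set \<Rightarrow> nat \<Rightarrow> 'a set set \<Rightarrow> 'a set set \<Rightarrow> bool" where
  "corresponds_to_swap V U j E D \<longleftrightarrow>
     (\<exists>xs. alternating_cycle V U E xs \<and> length xs = j \<and> D = cycle_pairs xs)"

end

theory Submission
  imports Defs
begin

text \<open>
  Induction on the size of the symmetric difference $D$ of the two realisations. Equal degrees
  let every edge of $D$ be continued to an alternating walk, so $D$ contains an alternating cycle
  $C$ without repeated vertices. If $C \neq D$, first swap along $C$ and apply the induction
  hypothesis twice. If $C = D$ has length at most six, it is a single swap. Otherwise the chords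
  of $C$ joining positions $0,3,6,1,4,7,2,5,0$ form an 8-cycle, so one of them is not fixed. It cuts
  off a cycle of length four or six which alternates in one of the two realisations; swapping there
  gives an intermediate realisation $H$ whose distances to both ends are smaller than $|D|$ and add
  up to $|D| + 2$. This is what the bound of $|D|/2 - 1$ swaps requires.
\<close>

section \<open>Vertex pairs, cyclic indices and parity\<close>

lemma finite_vertex_pairs:
  assumes "finite V" "finite U"
  shows "finite (vertex_pairs V U)"
proof -
  have "vertex_pairs V U = (\<lambda>(x, y). {x, y}) ` (V \<times> U)"
    by (auto simp: vertex_pairs_def)
  then show ?thesis using assms by simp
qed

lemma vertex_pairs_other_end:
  assumes "e \<in> vertex_pairs V U" "x \<in> e"
  obtains y where "e = {x, y}" "y \<in> V \<union> U"
  using assms by (auto simp: vertex_pairs_def insert_commute)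

lemma vertex_pairs_iff:
  assumes "V \<inter> U = {}"
  shows "{x, y} \<in> vertex_pairs V U \<longleftrightarrow> x \<in> V \<union> U \<and> y \<in> V \<union> U \<and> (x \<in> V \<longleftrightarrow> y \<notin> V)"
  using assms by (auto simp: vertex_pairs_def doubleton_eq_iff)

lemma cycle_pair_less:
  "i < length xs \<Longrightarrow> cycle_pair xs i = {xs ! i, xs ! (Suc i mod length xs)}"
  by (simp add: cycle_pair_def)

lemma cycle_pair_mod: "cycle_pair xs (i mod length xs) = cycle_pair xs i"
  by (simp add: cycle_pair_def mod_Suc_eq)

lemma cycle_pair_in_cycle_pairs: "xs \<noteq> [] \<Longrightarrow> cycle_pair xs i \<in> cycle_pairs xs"
  unfolding cycle_pairs_def by (metis cycle_pair_mod imageI length_greater_0_conv lessThan_iff mod_less_divisor)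

lemma Suc_mod_cases:
  fixes i n :: nat
  assumes "i < n"
  shows "Suc i mod n = (if Suc i = n then 0 else Suc i)"
  using assms by auto

text \<open>Two distinct positions with the same pair would be cyclic successors of each other,
  which happens only in a list of length two.\<close>

lemma inj_on_cycle_pair:
  assumes "distinct xs" "length xs \<ge> 3"
  shows "inj_on (cycle_pair xs) {..<length xs}"
proof (rule inj_onI)
  fix i j assume ij: "i \<in> {..<length xs}" "j \<in> {..<length xs}"
    and eq: "cycle_pair xs i = cycle_pair xs j"
  have l: "Suc i mod length xs < length xs" "Suc j mod length xs < length xs"
    using assms by (auto intro!: mod_less_divisor)
  from eq ij l have "i = j \<or> (i = Suc j mod length xs \<and> j = Suc i mod length xs)"
    by (auto simp: cycle_pair_less doubleton_eq_iff nth_eq_iff_index_eq[OF assms(1)])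
  then show "i = j" using ij assms(2)
    by (auto simp: Suc_mod_cases split: if_splits)
qed

lemma card_cycle_pairs:
  assumes "distinct xs" "length xs \<ge> 3"
  shows "card (cycle_pairs xs) = length xs"
  unfolding cycle_pairs_def using card_image[OF inj_on_cycle_pair[OF assms]] by simp

text \<open>The single bit \<open>cycle_pair xs 0 \<in> E\<close> determines membership at every
  index. Index \<open>length xs\<close> names pair 0 again, so the length must be even.\<close>

lemma alternating_cycle_parity:
  assumes "alternating_cycle V U E xs"
  shows "cycle_pair xs i \<in> E \<longleftrightarrow> (even i \<longleftrightarrow> cycle_pair xs 0 \<in> E)"
    and "even (length xs)"
proof -
  have ne: "xs \<noteq> []" using assms by (auto simp: alternating_cycle_def is_cycle_def)
  \<comment> \<open>The definition gives alternation only for indices below the length; reduction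
    modulo the length extends it to all of them.\<close>
  have step: "cycle_pair xs i \<in> E \<longleftrightarrow> cycle_pair xs (Suc i) \<notin> E" for i
  proof -
    have "i mod length xs < length xs" using ne by simp
    then have "cycle_pair xs (i mod length xs) \<in> E \<longleftrightarrow> cycle_pair xs (Suc (i mod length xs)) \<notin> E"
      using assms unfolding alternating_cycle_def by blast
    moreover have "cycle_pair xs (Suc (i mod length xs)) = cycle_pair xs (Suc i)"
      by (metis cycle_pair_mod mod_Suc_eq)
    ultimately show ?thesis by (simp add: cycle_pair_mod)
  qed
  show par: "cycle_pair xs i \<in> E \<longleftrightarrow> (even i \<longleftrightarrow> cycle_pair xs 0 \<in> E)" for i
    proof (induction i)
    case 0
    show ?case by simp
  next
    case (Suc i)
    then show ?case using step[of i] by (metis even_Suc)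
  qed
  have closed: "cycle_pair xs (length xs) = cycle_pair xs 0"
    using cycle_pair_mod[of xs "length xs"] by simp
  show "even (length xs)"
    using par[of "length xs"] unfolding closed by blast
qed

text \<open>Bridge from walks given as functions to the list encoding of cycles. The bit
  \<open>c\<close> says whether the first pair lies in \<open>E\<close>; evenness of
  \<open>n\<close> keeps the alternation intact at the wrap-around.\<close>

lemma closed_walk_cycle:
  fixes w :: "nat \<Rightarrow> 'a"
  assumes "n \<ge> 3" "even n" "inj_on w {..<n}" "w n = w 0"
    and "\<And>i. i < n \<Longrightarrow> {w i, w (Suc i)} \<in> vertex_pairs V U"
    and "\<And>i. i < n \<Longrightarrow> {w i, w (Suc i)} \<in> E \<longleftrightarrow> (even i \<longleftrightarrow> c)"
  shows "alternating_cycle V U E (map w [0..<n])"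
    and "cycle_pairs (map w [0..<n]) = (\<lambda>i. {w i, w (Suc i)}) ` {..<n}"
proof -
  let ?xs = "map w [0..<n]"
  have cp: "cycle_pair ?xs i = {w i, w (Suc i)}" if "i < n" for i
    using that assms(4) by (auto simp: cycle_pair_less Suc_mod_cases)
  then show cps: "cycle_pairs ?xs = (\<lambda>i. {w i, w (Suc i)}) ` {..<n}"
    by (auto simp: cycle_pairs_def)
  have "distinct ?xs" using assms(3) by (simp add: distinct_map lessThan_atLeast0)
  then have "is_cycle (vertex_pairs V U) ?xs"
    using assms(1,5) by (auto simp: is_cycle_def cps)
  moreover have "cycle_pair ?xs i \<in> E \<longleftrightarrow> cycle_pair ?xs (Suc i) \<notin> E" if "i < n" for i
  proof (cases "Suc i = n")
    case True
    then have "cycle_pair ?xs (Suc i) = cycle_pair ?xs 0"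
      using cycle_pair_mod[of ?xs n] by simp
    then show ?thesis using assms(1,2) assms(6)[of i] assms(6)[of 0] that True by (auto simp: cp)
  next
    case False
    then have "Suc i < n" using that by simp
    then show ?thesis using assms(6)[of i] assms(6)[of "Suc i"] that by (simp add: cp)
  qed
  ultimately show "alternating_cycle V U E ?xs" by (simp add: alternating_cycle_def)
qed

section \<open>Swaps preserve degrees and realisations\<close>

text \<open>A vertex of the cycle lies on exactly two of its pairs, one in \<open>E\<close> and one
  outside, so the swap trades one incident edge for another.\<close>

lemma degree_swap:
  assumes "finite E" "alternating_cycle V U E xs"
  shows "degree (sym_diff E (cycle_pairs xs)) x = degree E x"
proof (cases "x \<in> set xs")
  case False
  have "x \<notin> e" if e: "e \<in> cycle_pairs xs" for e
  proof -
    obtain i where "i < length xs" "e = cycle_pair xs i"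
      using e by (auto simp: cycle_pairs_def)
    moreover have "Suc i mod length xs < length xs" using \<open>i < length xs\<close>
      by (intro mod_less_divisor) linarith
    ultimately show ?thesis using False by (auto simp: cycle_pair_less)
  qed
  then have "{e \<in> sym_diff E (cycle_pairs xs). x \<in> e} = {e \<in> E. x \<in> e}" by auto
  then show ?thesis by (simp add: degree_def)
next
  case True
  let ?n = "length xs" and ?C = "cycle_pairs xs"
  have d: "distinct xs" "?n \<ge> 3"
    using assms(2) by (auto simp: alternating_cycle_def is_cycle_def)
  obtain m where m: "m < ?n" "x = xs ! m" using True by (auto simp: in_set_conv_nth)
  \<comment> \<open>\<open>k\<close> is the cyclic predecessor of \<open>m\<close>, so
    \<open>e1\<close> and \<open>e2\<close> are the two pairs of the cycle at
    \<open>x\<close>.\<close>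
  define k where "k = (if m = 0 then ?n - 1 else m - 1)"
  have k: "k < ?n" "m = Suc k mod ?n"
    using m d(2) by (auto simp: k_def)
  define e1 e2 where "e1 = cycle_pair xs k" and "e2 = cycle_pair xs m"
  have e2': "e2 = cycle_pair xs (Suc k)" unfolding e2_def k(2) by (rule cycle_pair_mod)
  have alt: "e1 \<in> E \<longleftrightarrow> e2 \<notin> E"
    using assms(2) k(1) unfolding e1_def e2' alternating_cycle_def by blast
  have inC: "e1 \<in> ?C" "e2 \<in> ?C"
    using m(1) k(1) by (auto simp: e1_def e2_def cycle_pairs_def)
  have inx: "x \<in> e1" "x \<in> e2"
    by (simp_all add: e1_def e2_def cycle_pair_less m(1) k(1) k(2)[symmetric] m(2))
  have only: "e = e1 \<or> e = e2" if e: "e \<in> ?C" "x \<in> e" for e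
  proof -
    obtain i where i: "i < ?n" "e = cycle_pair xs i" using e(1) by (auto simp: cycle_pairs_def)
    have l: "Suc i mod ?n < ?n" using d by (intro mod_less_divisor) linarith
    have "m = i \<or> m = Suc i mod ?n"
      using e(2) i l m by (auto simp: cycle_pair_less nth_eq_iff_index_eq[OF d(1)])
    then have "m = i \<or> k = i" using i(1) m(1) by (auto simp: k_def Suc_mod_cases split: if_splits)
    then show ?thesis using i by (auto simp: e1_def e2_def)
  qed
  \<comment> \<open>Stated for generic \<open>a\<close> and \<open>b\<close> because either of
    \<open>e1\<close>, \<open>e2\<close> may be the one in \<open>E\<close>.\<close>
  have exch: "degree (sym_diff E ?C) x = degree E x"
    if "a \<in> ?C" "b \<in> ?C" "x \<in> a" "x \<in> b" "a \<in> E" "b \<notin> E" "\<And>e. e \<in> ?C \<Longrightarrow> x \<in> e \<Longrightarrow> e = a \<or> e = b" for a b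
  proof -
    let ?A = "{e \<in> E. x \<in> e}"
    have "{e \<in> sym_diff E ?C. x \<in> e} = insert b (?A - {a})"
      using that by blast
    moreover have "card (insert b (?A - {a})) = card ?A"
      using assms(1) that card_Suc_Diff1[of ?A a] by simp
    ultimately show ?thesis by (simp add: degree_def)
  qed
  show ?thesis
    using exch[of e1 e2] exch[of e2 e1] inC inx alt only by blast
qed

lemma fixed_realisation_swap:
  assumes "fixed_realisation n n' v u a b FE FN G"
    and "alternating_cycle (v ` {1..n}) (u ` {1..n'}) G xs"
    and "cycle_pairs xs \<inter> (FE \<union> FN) = {}"
  shows "fixed_realisation n n' v u a b FE FN (sym_diff G (cycle_pairs xs))"
proof -
  have "finite G"
    using assms(1) finite_subset[OF _ finite_vertex_pairs[of "v ` {1..n}" "u ` {1..n'}"]]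
    by (auto simp: fixed_realisation_def)
  note deg = degree_swap[OF this assms(2)]
  have "cycle_pairs xs \<subseteq> vertex_pairs (v ` {1..n}) (u ` {1..n'})"
    using assms(2) by (auto simp: alternating_cycle_def is_cycle_def)
  then show ?thesis
    using assms(1,3) unfolding fixed_realisation_def deg by blast
qed

section \<open>An alternating cycle in the symmetric difference\<close>

text \<open>Otherwise the \<open>B\<close>-edges at \<open>x\<close> would all be
  \<open>A\<close>-edges and miss \<open>e\<close>, giving \<open>B\<close> the smaller degree. This
  continues an alternating walk.\<close>

lemma exchange_edge_at:
  assumes "finite A" "degree A x = degree B x" "e \<in> A - B" "x \<in> e"
  shows "\<exists>e'\<in>B - A. x \<in> e'"
proof (rule ccontr)
  assume "\<not> ?thesis"
  then have "{e \<in> B. x \<in> e} \<subset> {e \<in> A. x \<in> e}" using assms(3,4) by blast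
  then have "card {e \<in> B. x \<in> e} < card {e \<in> A. x \<in> e}"
    using assms(1) by (intro psubset_card_mono) auto
  then show False using assms(2) by (simp add: degree_def)
qed

text \<open>The alternating walk never stops but lives on finitely many vertices; the stretch
  between its earliest return to a vertex and the previous visit there is the cycle.\<close>

lemma alternating_cycle_in_sym_diff:
  assumes "finite V" "finite U" "V \<inter> U = {}"
    and "G \<subseteq> vertex_pairs V U" "G' \<subseteq> vertex_pairs V U"
    and "\<And>x. x \<in> V \<union> U \<Longrightarrow> degree G x = degree G' x"
    and "G \<noteq> G'"
  obtains xs where "alternating_cycle V U G xs" "cycle_pairs xs \<subseteq> sym_diff G G'"
proof -
  let ?D = "sym_diff G G'"
  have fin: "finite G" "finite G'"
    using assms finite_subset[OF _ finite_vertex_pairs] by blast+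
  have D: "?D \<subseteq> vertex_pairs V U" using assms by blast
  obtain e0 where e0: "e0 \<in> ?D" using assms(7) by blast
  then obtain x0 y0 where xy0: "e0 = {x0, y0}" using D by (auto simp: vertex_pairs_def)
  define c where "c \<longleftrightarrow> e0 \<in> G"
  \<comment> \<open>The state \<open>f n\<close> is the \<open>n\<close>-th edge together with its
    direction, so that the next edge can be chosen at the end vertex
    \<open>snd (f n)\<close>.\<close>
  have "\<exists>f. \<forall>n. ({fst (f n), snd (f n)} \<in> ?D \<and> ({fst (f n), snd (f n)} \<in> G \<longleftrightarrow> (even n \<longleftrightarrow> c)))
      \<and> fst (f (Suc n)) = snd (f n)"
  proof (rule dependent_nat_choice)
    show "\<exists>p. {fst p, snd p} \<in> ?D \<and> ({fst p, snd p} \<in> G \<longleftrightarrow> (even 0 \<longleftrightarrow> c))"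
      using e0 xy0 by (intro exI[of _ "(x0, y0)"]) (simp add: c_def)
  next
    fix p :: "'a \<times> 'a" and n :: nat
    assume p: "{fst p, snd p} \<in> ?D \<and> ({fst p, snd p} \<in> G \<longleftrightarrow> (even n \<longleftrightarrow> c))"
    let ?e = "{fst p, snd p}" and ?y = "snd p"
    have "?y \<in> V \<union> U" using p D vertex_pairs_iff[OF assms(3), of "fst p" ?y] by blast
    then have deg: "degree G ?y = degree G' ?y" by (rule assms(6))
    have "\<exists>e'\<in>?D. ?y \<in> e' \<and> (e' \<in> G \<longleftrightarrow> ?e \<notin> G)"
    proof (cases "?e \<in> G")
      case True
      then have "?e \<in> G - G'" using p by blast
      from exchange_edge_at[OF fin(1) deg this] show ?thesis using True by auto
    next
      case False
      then have "?e \<in> G' - G" using p by blast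
      from exchange_edge_at[OF fin(2) deg[symmetric] this] show ?thesis using False by auto
    qed
    then obtain e' where e': "e' \<in> ?D" "?y \<in> e'" "e' \<in> G \<longleftrightarrow> ?e \<notin> G" by blast
    obtain z where "e' = {?y, z}"
      using vertex_pairs_other_end[of e' V U ?y] e'(1,2) D by blast
    then show "\<exists>q. ({fst q, snd q} \<in> ?D \<and> ({fst q, snd q} \<in> G \<longleftrightarrow> (even (Suc n) \<longleftrightarrow> c))) \<and> fst q = snd p"
      using e' p by (intro exI[of _ "(?y, z)"]) auto
  qed
  then obtain f where f: "\<And>n. {fst (f n), snd (f n)} \<in> ?D"
    "\<And>n. {fst (f n), snd (f n)} \<in> G \<longleftrightarrow> (even n \<longleftrightarrow> c)" "\<And>n. fst (f (Suc n)) = snd (f n)"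
    by blast
  define w where "w n = fst (f n)" for n
  have wD: "{w n, w (Suc n)} \<in> ?D" and wG: "{w n, w (Suc n)} \<in> G \<longleftrightarrow> (even n \<longleftrightarrow> c)" for n
    using f by (simp_all add: w_def)
  have wVU: "w n \<in> V \<union> U" and wpar: "w n \<in> V \<longleftrightarrow> w (Suc n) \<notin> V" for n
    using wD[of n] D vertex_pairs_iff[OF assms(3), of "w n" "w (Suc n)"] by blast+
  have wV: "w n \<in> V \<longleftrightarrow> (even n \<longleftrightarrow> w 0 \<in> V)" for n :: nat
  proof (induction n)
    case 0
    show ?case by simp
  next
    case (Suc n)
    then show ?case using wpar[of n] by (metis even_Suc)
  qed
  have "range w \<subseteq> V \<union> U" using wVU by blast
  then have "finite (range w)" using assms(1,2) finite_subset by blast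
  then have "\<not> inj w" using finite_imageD by blast
  then obtain r s where "w r = w s" "r \<noteq> s" unfolding inj_def by blast
  then have "\<exists>j. \<exists>i<j. w i = w j" by (metis linorder_neqE_nat)
  \<comment> \<open>With \<open>j\<close> minimal, no vertex repeats before index \<open>j\<close>,
    so the walk is injective from \<open>i\<close> to \<open>j - 1\<close>.\<close>
  then obtain j where j: "\<exists>i<j. w i = w j" and minj: "\<And>j'. j' < j \<Longrightarrow> \<not> (\<exists>i<j'. w i = w j')"
    using exists_least_iff[of "\<lambda>j. \<exists>i<j. w i = w j"] by blast
  from j obtain i where i: "i < j" "w i = w j" by blast
  define n where "n = j - i"
  \<comment> \<open>The walk changes sides at each step, so equal vertices have indices of equal
    parity.\<close>
  have ev: "even n" using wV[of i] wV[of j] i by (auto simp: n_def)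
  \<comment> \<open>A return after two steps would use one edge twice in a row, yet consecutive
    edges differ in membership in \<open>G\<close>.\<close>
  have "n \<noteq> 2"
  proof
    assume "n = 2"
    then have "j = Suc (Suc i)" using i(1) by (simp add: n_def)
    then have "w (Suc (Suc i)) = w i" using i(2) by simp
    then show False using wG[of i] wG[of "Suc i"] by (simp add: insert_commute) blast
  qed
  moreover have "n \<noteq> 1" using ev by auto
  moreover have "n \<noteq> 0" using i(1) by (simp add: n_def)
  ultimately have n3: "n \<ge> 3" by linarith
  have inj: "inj_on (\<lambda>k. w (i + k)) {..<n}"
  proof (rule linorder_inj_onI')
    fix x y assume "x < y" "x \<in> {..<n}" "y \<in> {..<n}"
    then show "w (i + x) \<noteq> w (i + y)" using minj[of "i + y"] by (auto simp: n_def)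
  qed
  have "{w (i + k), w (i + Suc k)} \<in> vertex_pairs V U" for k using wD[of "i + k"] D by auto
  \<comment> \<open>Starting at \<open>i\<close> instead of 0 shifts the parity, which changes the
    alternation bit from \<open>c\<close> to \<open>even i \<longleftrightarrow> c\<close>.\<close>
  moreover have "{w (i + k), w (i + Suc k)} \<in> G \<longleftrightarrow> (even k \<longleftrightarrow> (even i \<longleftrightarrow> c))" for k
    using wG[of "i + k"] by auto
  moreover have "w (i + n) = w (i + 0)" using i by (simp add: n_def)
  ultimately have "alternating_cycle V U G (map (\<lambda>k. w (i + k)) [0..<n])"
    and cps: "cycle_pairs (map (\<lambda>k. w (i + k)) [0..<n]) = (\<lambda>k. {w (i + k), w (i + Suc k)}) ` {..<n}"
    using closed_walk_cycle[of n "\<lambda>k. w (i + k)" V U G "even i \<longleftrightarrow> c"] n3 ev inj by blast+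
  moreover have "cycle_pairs (map (\<lambda>k. w (i + k)) [0..<n]) \<subseteq> ?D"
    unfolding cps using wD by auto
  ultimately show thesis by (intro that)
qed

section \<open>Chords of a long alternating cycle\<close>

lemma non_fixed_chord:
  assumes "is_cycle E xs" "length xs \<ge> 8" "\<not> contains_cycle_of_length 8 F"
  obtains p q where "p < q" "q < 8" "q - p = 3 \<or> q - p = 5" "{xs ! p, xs ! q} \<notin> F"
proof -
  \<comment> \<open>Stepping by 3 through the indices modulo 8 visits all of them, always along chords of \<open>xs\<close>.\<close>
  let ?js = "[0, 3, 6, 1, 4, 7, 2, 5] :: nat list"
  let ?ys = "map ((!) xs) ?js"
  have "inj_on ((!) xs) (set ?js)"
    using assms(1,2) by (intro inj_on_nth) (auto simp: is_cycle_def)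
  moreover have "distinct ?js" by simp
  ultimately have "distinct ?ys" by (simp only: distinct_map)
  then have "\<not> cycle_pairs ?ys \<subseteq> F"
    using assms(3) by (auto simp: contains_cycle_of_length_def is_cycle_def simp del: distinct.simps)
  moreover have "length ?ys = 8" by simp
  ultimately obtain i where i: "i < 8" "cycle_pair ?ys i \<notin> F"
    unfolding cycle_pairs_def by (metis image_subsetI lessThan_iff)
  have "i = 0 \<or> i = 1 \<or> i = 2 \<or> i = 3 \<or> i = 4 \<or> i = 5 \<or> i = 6 \<or> i = 7" using i(1) by linarith
  \<comment> \<open>Each chord is written with its smaller index first: a step of 3 that passes 8
    goes down by 5, hence the differences 3 and 5.\<close>
  then have "cycle_pair ?ys i \<in> {{xs ! 0, xs ! 3}, {xs ! 3, xs ! 6}, {xs ! 1, xs ! 6}, {xs ! 1, xs ! 4},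
      {xs ! 4, xs ! 7}, {xs ! 2, xs ! 7}, {xs ! 2, xs ! 5}, {xs ! 0, xs ! 5}}"
    by (elim disjE) (simp_all add: cycle_pair_def insert_commute)
  then show thesis using i(2) that[of 0 3] that[of 3 6] that[of 1 6] that[of 1 4] that[of 4 7]
      that[of 2 7] that[of 2 5] that[of 0 5] by auto
qed

text \<open>The chord spans an odd distance, so it joins opposite sides and closes the path from
  \<open>p\<close> to \<open>q\<close> into a cycle of length 4 or 6. There it takes the place of
  the pair with index \<open>q\<close>, hence the condition
  \<open>even q \<longleftrightarrow> c\<close>. Keeping \<open>E\<close> and \<open>c\<close>
  general allows use with both realisations, whose bits are opposite.\<close>

lemma chord_cycle:
  assumes "V \<inter> U = {}" "is_cycle (vertex_pairs V U) xs" "length xs \<ge> 8"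
    and "p < q" "q < 8" "q - p = 3 \<or> q - p = 5"
  obtains ys where "cycle_pairs ys = insert {xs ! p, xs ! q} (cycle_pair xs ` {p..<q})"
    and "{xs ! p, xs ! q} \<notin> cycle_pairs xs"
    and "\<And>E c. (\<And>i. cycle_pair xs i \<in> E \<longleftrightarrow> (even i \<longleftrightarrow> c)) \<Longrightarrow>
           ({xs ! p, xs ! q} \<in> E \<longleftrightarrow> (even q \<longleftrightarrow> c)) \<Longrightarrow> alternating_cycle V U E ys"
proof -
  let ?l = "length xs" and ?m = "Suc (q - p)"
  \<comment> \<open>Indices 0 to \<open>q - p\<close> run along \<open>xs\<close> from
    \<open>p\<close> to \<open>q\<close>; the special value at \<open>?m\<close> returns to the
    start along the chord.\<close>
  define w where "w i = (if i = ?m then xs ! p else xs ! (p + i))" for i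
  define ys where "ys = map w [0..<?m]"
  have d: "distinct xs" and vp: "cycle_pairs xs \<subseteq> vertex_pairs V U"
    using assms(2) by (auto simp: is_cycle_def)
  have cp: "cycle_pair xs i = {xs ! i, xs ! Suc i}" if "Suc i < ?l" for i
    using that by (simp add: cycle_pair_less)
  have odd: "odd (q - p)" using assms(6) by (elim disjE) simp_all
  have edge: "{xs ! i, xs ! Suc i} \<in> vertex_pairs V U" if "Suc i < ?l" for i
    using vp that unfolding cycle_pairs_def cp[OF that, symmetric] by auto
  have inVU: "xs ! i \<in> V \<union> U" and par: "xs ! i \<in> V \<longleftrightarrow> xs ! Suc i \<notin> V" if "Suc i < ?l" for i
    using edge[OF that] vertex_pairs_iff[OF assms(1)] by blast+
  have parity: "xs ! i \<in> V \<longleftrightarrow> (even i \<longleftrightarrow> xs ! 0 \<in> V)" if "i < ?l" for i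
    using that
  proof (induction i)
    case 0
    show ?case by simp
  next
    case (Suc i)
    then show ?case using par[of i] by (metis Suc_lessD even_Suc)
  qed
  have lq: "q < ?l" "p < ?l" using assms by auto
  have "xs ! q \<in> V \<union> U"
  proof -
    have "Suc (q - 1) < ?l" "Suc (q - 1) = q" using assms by auto
    then show ?thesis using edge[of "q - 1"] vertex_pairs_iff[OF assms(1), of "xs ! (q - 1)"] by simp
  qed
  moreover have "xs ! p \<in> V \<longleftrightarrow> xs ! q \<notin> V"
    using parity[OF lq(1)] parity[OF lq(2)] odd assms(4) by (auto simp: even_diff_nat)
  ultimately have chord: "{xs ! p, xs ! q} \<in> vertex_pairs V U"
    using inVU[of p] assms vertex_pairs_iff[OF assms(1)] by auto
  \<comment> \<open>Positions of a pair of \<open>xs\<close> differ by 1 or by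
    \<open>length xs - 1\<close>, which is at least 7; those of the chord differ by 3 or 5.\<close>
  have notin: "{xs ! p, xs ! q} \<notin> cycle_pairs xs"
  proof
    assume "{xs ! p, xs ! q} \<in> cycle_pairs xs"
    then obtain i where i: "i < ?l" "{xs ! p, xs ! q} = {xs ! i, xs ! (Suc i mod ?l)}"
      by (auto simp: cycle_pairs_def cycle_pair_less)
    moreover have "Suc i mod ?l < ?l" using i(1) by (intro mod_less_divisor) linarith
    ultimately have "(p = i \<and> q = Suc i mod ?l) \<or> (p = Suc i mod ?l \<and> q = i)"
      using lq by (auto simp: doubleton_eq_iff nth_eq_iff_index_eq[OF d])
    then show False using i(1) assms by (auto simp: Suc_mod_cases split: if_splits)
  qed
  have inj: "inj_on w {..<?m}"
    using d assms by (auto simp: inj_on_def w_def nth_eq_iff_index_eq)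
  have wp: "{w i, w (Suc i)} = cycle_pair xs (p + i)" if "i < q - p" for i
    using that assms by (auto simp: w_def cp)
  have wc: "{w i, w (Suc i)} = {xs ! p, xs ! q}" if "i = q - p" for i
    using that assms by (auto simp: w_def)
  have wvp: "{w i, w (Suc i)} \<in> vertex_pairs V U" if "i < ?m" for i
  proof (cases "i = q - p")
    case True then show ?thesis using wc chord by simp
  next
    case False
    moreover have "xs \<noteq> []" using assms(3) by auto
    ultimately show ?thesis
      using wp[of i] that vp cycle_pair_in_cycle_pairs[of xs "p + i"] by auto
  qed
  have prems: "?m \<ge> 3" "even ?m" "w ?m = w 0" using assms(6) odd by (auto simp: w_def)
  have alt: "alternating_cycle V U E ys"
    if E: "\<And>i. cycle_pair xs i \<in> E \<longleftrightarrow> (even i \<longleftrightarrow> c)" "{xs ! p, xs ! q} \<in> E \<longleftrightarrow> (even q \<longleftrightarrow> c)" for E c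
  proof -
    have "{w i, w (Suc i)} \<in> E \<longleftrightarrow> (even i \<longleftrightarrow> (even p \<longleftrightarrow> c))" if "i < ?m" for i
    proof (cases "i = q - p")
      case True then show ?thesis using wc[OF True] E(2) assms(4) by (auto simp: even_diff_nat)
    next
      case False
      then show ?thesis using wp[of i] that E(1)[of "p + i"] by auto
    qed
    from closed_walk_cycle[of ?m w V U E, OF prems(1,2) inj prems(3) wvp this]
    show "alternating_cycle V U E ys" unfolding ys_def by blast
  qed
  have ys_cp: "cycle_pair ys i = {w i, w (Suc i)}" if "i < ?m" for i
    using that prems(3) by (auto simp: ys_def cycle_pair_less Suc_mod_cases simp del: upt_Suc)
  have "cycle_pairs ys = (\<lambda>i. {w i, w (Suc i)}) ` {..<?m}"
    unfolding cycle_pairs_def by (intro image_cong) (auto simp: ys_cp, simp add: ys_def)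
  also have "{..<?m} = insert (q - p) {..<q - p}" by auto
  also have "(\<lambda>i. {w i, w (Suc i)}) ` \<dots> = insert {xs ! p, xs ! q} ((\<lambda>i. cycle_pair xs (p + i)) ` {..<q - p})"
    using wc wp by simp
  also have "(\<lambda>i. cycle_pair xs (p + i)) ` {..<q - p} = cycle_pair xs ` {p..<q}"
    using image_add_atLeastLessThan[of p 0 "q - p"] assms(4)
    by (simp add: image_image[symmetric, of "cycle_pair xs" "(+) p"] lessThan_atLeast0)
  finally have "cycle_pairs ys = insert {xs ! p, xs ! q} (cycle_pair xs ` {p..<q})" .
  then show thesis using that notin alt by blast
qed

section \<open>Induction on the symmetric difference\<close>

text \<open>As a relation, steps can be iterated with \<open>^^\<close> and sequences concatenated;
  requiring both ends to be realisations makes a path carry the validity of its intermediate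
  graphs.\<close>

definition swap_step where
  "swap_step n n' v u a b FE FN G H \<longleftrightarrow>
     fixed_realisation n n' v u a b FE FN G \<and> fixed_realisation n n' v u a b FE FN H \<and>
     (\<exists>j\<in>{4, 6}. corresponds_to_swap (v ` {1..n}) (u ` {1..n'}) j G (sym_diff G H))"

text \<open>Here \<open>m\<close> counts swaps, so there are \<open>m + 1\<close> realisations and
  the bound is that of the theorem. Adding the bounds of two subsequences yields 4 on the left, so
  the distances may exceed \<open>card ?D\<close> by 2 in total: exactly the cost of counting a
  chord in both.\<close>

lemma swap_sequence:
  fixes v u :: "nat \<Rightarrow> 'a"
  assumes disj: "v ` {1..n} \<inter> u ` {1..n'} = {}"
    and F8: "\<not> contains_cycle_of_length 8 (FE \<union> FN)"
  shows "fixed_realisation n n' v u a b FE FN G \<Longrightarrow> fixed_realisation n n' v u a b FE FN G' \<Longrightarrow>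
    G \<noteq> G' \<Longrightarrow>
    \<exists>m. 2 * m + 2 \<le> card (sym_diff G G') \<and> (swap_step n n' v u a b FE FN ^^ m) G G'"
proof (induction "card (sym_diff G G')" arbitrary: G G' rule: less_induct)
  case less
  let ?V = "v ` {1..n}" and ?U = "u ` {1..n'}" and ?D = "sym_diff G G'" and ?F = "FE \<union> FN"
  let ?R = "fixed_realisation n n' v u a b FE FN" and ?S = "swap_step n n' v u a b FE FN"
  have deg: "degree G x = degree G' x" if "x \<in> ?V \<union> ?U" for x
    using less.prems(1,2) that by (auto simp: fixed_realisation_def)
  have sub: "G \<subseteq> vertex_pairs ?V ?U" "G' \<subseteq> vertex_pairs ?V ?U" and DF: "?D \<inter> ?F = {}"
    using less.prems by (auto simp: fixed_realisation_def)
  then have "finite G" "finite G'"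
    using finite_subset[OF _ finite_vertex_pairs[of ?V ?U]] by auto
  then have finD: "finite ?D" by simp
  have split: ?case
    if H: "?R H" "H \<noteq> G" "H \<noteq> G'" "card (sym_diff G H) + card (sym_diff H G') \<le> card ?D + 2"
      "card (sym_diff G H) < card ?D" "card (sym_diff H G') < card ?D" for H
  proof -
    obtain m1 where m1: "2 * m1 + 2 \<le> card (sym_diff G H)" "(?S ^^ m1) G H"
      using less.hyps[OF H(5) less.prems(1) H(1)] H(2) by blast
    obtain m2 where m2: "2 * m2 + 2 \<le> card (sym_diff H G')" "(?S ^^ m2) H G'"
      using less.hyps[OF H(6,1) less.prems(2)] H(3) by blast
    have "(?S ^^ (m1 + m2)) G G'" using m1(2) m2(2) by (auto simp: relpowp_add)
    moreover have "2 * (m1 + m2) + 2 \<le> card ?D" using m1(1) m2(1) H(4) by simp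
    ultimately show ?thesis by blast
  qed
  obtain xs where xs: "alternating_cycle ?V ?U G xs" "cycle_pairs xs \<subseteq> ?D"
    using alternating_cycle_in_sym_diff[OF _ _ disj sub deg less.prems(3)] by auto
  have cyc: "is_cycle (vertex_pairs ?V ?U) xs" using xs(1) by (simp add: alternating_cycle_def)
  then have d: "distinct xs" "length xs \<ge> 3" by (auto simp: is_cycle_def)
  note par = alternating_cycle_parity[OF xs(1)]
  let ?C = "cycle_pairs xs"
  have cardC: "card ?C = length xs" by (rule card_cycle_pairs[OF d])
  show ?case
  proof (cases "?C = ?D")
    \<comment> \<open>Swapping all of \<open>?C\<close> makes \<open>?H\<close> agree with
      \<open>G'\<close> there, so the distances are those of \<open>?C\<close> and of the nonempty
      rest, with sum \<open>card ?D\<close>.\<close>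
    case False
    let ?H = "sym_diff G ?C"
    have "?R ?H" using fixed_realisation_swap[OF less.prems(1) xs(1)] xs(2) DF by blast
    moreover have GH: "sym_diff G ?H = ?C" and HG': "sym_diff ?H G' = ?D - ?C"
      using xs(2) by blast+
    moreover have "card (?D - ?C) = card ?D - card ?C"
      using finD xs(2) by (intro card_Diff_subset) (auto intro: finite_subset)
    moreover have "card ?C < card ?D" using finD xs(2) False by (intro psubset_card_mono) auto
    moreover have "card ?C > 0" unfolding cardC using d(2) by linarith
    moreover have "?H \<noteq> G" "?H \<noteq> G'" using GH HG' False xs(2) calculation(6) by auto
    ultimately show ?thesis by (intro split[of ?H]) simp_all
  next
    case CD: True
    show ?thesis
    proof (cases "length xs < 8")
      case True
      then have "length xs \<in> {4, 6}" using par(2) d(2) by (cases "length xs = 5"; cases "length xs = 3"; cases "length xs = 7") auto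
      then have "?S G G'"
        using less.prems xs(1) CD unfolding swap_step_def corresponds_to_swap_def by blast
      then have "(?S ^^ 1) G G'" by (simp only: relpowp_1)
      moreover have "2 * 1 + 2 \<le> card ?D" using CD cardC \<open>length xs \<in> {4, 6}\<close> by auto
      ultimately show ?thesis by blast
    next
      case False
      then have len: "length xs \<ge> 8" by simp
      obtain p q where pq: "p < q" "q < 8" "q - p = 3 \<or> q - p = 5" "{xs ! p, xs ! q} \<notin> ?F"
        using non_fixed_chord[OF cyc len F8] by blast
      let ?e = "{xs ! p, xs ! q}" and ?P = "cycle_pair xs ` {p..<q}"
      obtain ys where cys: "cycle_pairs ys = insert ?e ?P" and eC: "?e \<notin> ?C"
        and alt: "\<And>E c. (\<And>i. cycle_pair xs i \<in> E \<longleftrightarrow> (even i \<longleftrightarrow> c)) \<Longrightarrow>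
           (?e \<in> E \<longleftrightarrow> (even q \<longleftrightarrow> c)) \<Longrightarrow> alternating_cycle ?V ?U E ys"
        using chord_cycle[OF disj cyc len pq(1-3)] by blast
      have PC: "?P \<subseteq> ?C" using pq len by (auto simp: cycle_pairs_def)
      have "inj_on (cycle_pair xs) {p..<q}"
        using inj_on_cycle_pair[OF d] pq len by (elim inj_on_subset) auto
      then have cardP: "card ?P = q - p" by (simp add: card_image)
      have finP: "finite ?P" by simp
      have card_ys: "card (cycle_pairs ys) = Suc (q - p)"
        using cys cardP PC eC finP by (subst cys, subst card_insert_disjoint) auto
      have cDP: "card (insert ?e (?D - ?P)) = Suc (card ?D - (q - p))"
        using finD eC CD cardP PC finP by (subst card_insert_disjoint) (auto simp: card_Diff_subset)
      \<comment> \<open>The two distances will be \<open>q - p + 1\<close> and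
        \<open>card ?D - (q - p) + 1\<close>. These bounds make both smaller than
        \<open>card ?D\<close>.\<close>
      have small: "q - p \<ge> 3" "q - p \<le> 5" "card ?D \<ge> 8" using pq(3) CD cardC len by auto
      have PF: "?P \<inter> ?F = {}" using PC DF unfolding CD by fast
      have ysF: "cycle_pairs ys \<inter> ?F = {}" unfolding cys using pq(4) PF by simp
      let ?c = "cycle_pair xs 0 \<in> G"
      have G': "cycle_pair xs i \<in> G' \<longleftrightarrow> (even i \<longleftrightarrow> \<not> ?c)" for i
      proof -
        have "xs \<noteq> []" using d(2) by auto
        then have "cycle_pair xs i \<in> ?D" unfolding CD[symmetric] by (rule cycle_pair_in_cycle_pairs)
        then have "cycle_pair xs i \<in> G' \<longleftrightarrow> cycle_pair xs i \<notin> G" by fast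
        then show ?thesis unfolding par(1)[of i] by fast
      qed
      have PD: "?P \<subseteq> ?D" "?e \<notin> ?D" using PC eC unfolding CD .
      have eG': "?e \<in> G' \<longleftrightarrow> ?e \<in> G" using PD(2) by fast
      \<comment> \<open>Effect of the short swap on the difference: the path \<open>?P\<close>
        disappears and the chord enters.\<close>
      have merge: "sym_diff D (insert e P) = insert e (D - P)" if "P \<subseteq> D" "e \<notin> D"
        for D P :: "'a set set" and e
        using that by blast
      show ?thesis
      \<comment> \<open>The chord lies in both realisations or in neither, whereas they differ on all of \<open>xs\<close>,
        so the short cycle \<open>ys\<close> alternates in exactly one of \<open>G\<close> and \<open>G'\<close>.\<close>
      proof (cases "?e \<in> G \<longleftrightarrow> (even q \<longleftrightarrow> ?c)")
        case True
        let ?H = "sym_diff G (cycle_pairs ys)"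
        have "alternating_cycle ?V ?U G ys" using alt[of G ?c] par(1) True by blast
        then have "?R ?H" using fixed_realisation_swap[OF less.prems(1)] ysF by blast
        moreover have GH: "sym_diff G ?H = cycle_pairs ys" by blast
        moreover have HG': "sym_diff ?H G' = insert ?e (?D - ?P)"
          unfolding merge[OF PD, symmetric] cys by blast
        moreover have "?H \<noteq> G" "?H \<noteq> G'"
          using GH HG' card_ys by auto
        ultimately show ?thesis
          by (intro split[of ?H]) (use card_ys cDP small in simp_all)
      next
        case False
        \<comment> \<open>The short swap is made at the far end, from \<open>G'\<close>. The forward
          sequence from \<open>?H\<close> to \<open>G'\<close> comes from the induction hypothesis,
          so no swap has to be reversed.\<close>
        let ?H = "sym_diff G' (cycle_pairs ys)"
        have "alternating_cycle ?V ?U G' ys" using alt[of G' "\<not> ?c"] G' eG' False by blast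
        then have "?R ?H" using fixed_realisation_swap[OF less.prems(2)] ysF by blast
        moreover have GH: "sym_diff ?H G' = cycle_pairs ys" by blast
        moreover have HG': "sym_diff G ?H = insert ?e (?D - ?P)"
          unfolding merge[OF PD, symmetric] cys by blast
        moreover have "?H \<noteq> G" "?H \<noteq> G'"
          using GH HG' card_ys by auto
        ultimately show ?thesis
          by (intro split[of ?H]) (use card_ys cDP small in simp_all)
      qed
    qed
  qed
qed

section \<open>From iterated steps to a numbered sequence\<close>

theorem corollary2:
  fixes n n' :: nat
    and v u :: "nat \<Rightarrow> 'a"
    and a b :: "nat \<Rightarrow> nat"
    and FE FN G G' :: "'a set set"
  assumes "inj_on v {1..n}" and "inj_on u {1..n'}"
    and "v ` {1..n} \<inter> u ` {1..n'} = {}"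
    and "\<forall>i\<in>{1..n}. a i > 0" and "\<forall>j\<in>{1..n'}. b j > 0"
    and "FE \<subseteq> vertex_pairs (v ` {1..n}) (u ` {1..n'})"
    and "FN \<subseteq> vertex_pairs (v ` {1..n}) (u ` {1..n'})"
    and "\<not> contains_cycle_of_length 8 (FE \<union> FN)"
    and "fixed_realisation n n' v u a b FE FN G"
    and "fixed_realisation n n' v u a b FE FN G'"
    and "G \<noteq> G'"
  shows "\<exists>(k::nat) (Gs :: nat \<Rightarrow> 'a set set).
           1 \<le> k \<and>
           (\<forall>i\<in>{1..k}. fixed_realisation n n' v u a b FE FN (Gs i)) \<and>
           Gs 1 = G \<and> Gs k = G' \<and>
           real k \<le> 1/2 * real (card (sym_diff G G')) \<and>
           (\<forall>i. 1 \<le> i \<and> i < k \<longrightarrow>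
              card (sym_diff (Gs i) (Gs (i+1))) \<le> 6 \<and>
              (\<exists>j\<in>{4, 6}. corresponds_to_swap (v ` {1..n}) (u ` {1..n'}) j (Gs i)
                            (sym_diff (Gs i) (Gs (i+1)))))"
proof -
  obtain m where m: "2 * m + 2 \<le> card (sym_diff G G')"
    and path: "(swap_step n n' v u a b FE FN ^^ m) G G'"
    using swap_sequence[OF assms(3,8,9,10,11)] by blast
  from path obtain f where f: "f 0 = G" "f m = G'"
    "\<And>i. i < m \<Longrightarrow> swap_step n n' v u a b FE FN (f i) (f (Suc i))"
    by (auto simp: relpowp_fun_conv)
  \<comment> \<open>The sequence is numbered from 1 and the path from 0, so \<open>k\<close> is
    \<open>m + 1\<close>.\<close>
  let ?Gs = "\<lambda>i. f (i - 1)"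
  have "fixed_realisation n n' v u a b FE FN (f i)" if "i \<le> m" for i
    \<comment> \<open>No step starts at index \<open>m\<close>; there validity is that of
      \<open>G'\<close>.\<close>
    using that f assms(10) by (cases "i = m") (auto simp: swap_step_def)
  moreover have "card (sym_diff (?Gs i) (?Gs (i + 1))) \<le> 6 \<and>
      (\<exists>j\<in>{4, 6}. corresponds_to_swap (v ` {1..n}) (u ` {1..n'}) j (?Gs i)
        (sym_diff (?Gs i) (?Gs (i + 1))))" if i: "1 \<le> i" "i < m + 1" for i
  proof -
    have "swap_step n n' v u a b FE FN (?Gs i) (?Gs (i + 1))"
      using f(3)[of "i - 1"] i by simp
    then obtain j where j: "j \<in> {4, 6}" "corresponds_to_swap (v ` {1..n}) (u ` {1..n'}) j (?Gs i)
        (sym_diff (?Gs i) (?Gs (i + 1)))" unfolding swap_step_def by blast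
    then obtain xs where "length xs = j" "sym_diff (?Gs i) (?Gs (i + 1)) = cycle_pairs xs"
      unfolding corresponds_to_swap_def by blast
    moreover have "card (cycle_pairs xs) \<le> length xs"
      unfolding cycle_pairs_def using card_image_le[of "{..<length xs}" "cycle_pair xs"] by simp
    ultimately show ?thesis using j by auto
  qed
  ultimately show ?thesis using f m by (intro exI[of _ "m + 1"] exI[of _ ?Gs]) auto
qed

end
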